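(* Let $\alpha>0$, let $n$ be the smallest integer greater than or equal to $\alpha$, and let $m\ge n$ be an integer. Then for $t>0$, $$D_{0+}^{\alpha}B_m(t)=\frac{\Gamma(m+1)}{\Gamma(m-n+1)}\sum_{k=0}^{m-n}\frac{k!\binom{m-n}{k}B_{m-n-k}}{\Gamma(n+k-\alpha+1)}\,t^{k-\alpha+n}.$$
   Context: The Caputo fractional derivative of order $\alpha>0$ is $D_{0+}^\alpha y(t)=\frac{1}{\Gamma(n-\alpha)}\int_0^t\frac{y^{(n)}(s)}{(t-s)^{\alpha-n+1}}ds$, where $n$ is the smallest integer greater than or equal to $\alpha$ (for $\alpha=n$ it is the ordinary derivative $y^{(n)}$). The Bernoulli polynomials $B_m(t)$ are defined by $\frac{z}{e^z-1}e^{tz}=\sum_{m=0}^\infty B_m(t)\frac{z^m}{m!}$ for $|z|<2\pi$, and $B_m:=B_m(0)$ are the Bernoulli numbers. *)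

theory Defs
  imports "HOL-Complex_Analysis.Complex_Analysis"
begin

(* The integral is a Lebesgue integral over [0, t]. Its integrand is 0 at the endpoint s = t
   because x / 0 = 0; this null set does not matter. *)
definition caputo_deriv :: "real \<Rightarrow> (real \<Rightarrow> real) \<Rightarrow> real \<Rightarrow> real" where
  "caputo_deriv \<alpha> y t =
    (let n = nat \<lceil>\<alpha>\<rceil> in
      if \<alpha> = real n then (deriv ^^ n) y t
      else 1 / Gamma (real n - \<alpha>) *
        (LBINT s:{0..t}. (deriv ^^ n) y s / (t - s) powr (\<alpha> - real n + 1)))"

(* z / (exp z - 1) * exp (t * z), with the removable singularity at 0 filled in *)
definition bernoulli_gen :: "real \<Rightarrow> complex \<Rightarrow> complex" where
  "bernoulli_gen t z =
    (if z = 0 then 1 else z / (exp z - 1) * exp (complex_of_real t * z))"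

definition is_bernoulli_family :: "(nat \<Rightarrow> real \<Rightarrow> real) \<Rightarrow> bool" where
  "is_bernoulli_family B \<longleftrightarrow>
    (\<forall>t z. norm z < 2 * pi \<longrightarrow>
      (\<lambda>m. complex_of_real (B m t) * z ^ m / fact m) sums bernoulli_gen t z)"

definition bernoulli_poly :: "nat \<Rightarrow> real \<Rightarrow> real" where
  "bernoulli_poly = (THE B. is_bernoulli_family B)"

definition bernoulli_num :: "nat \<Rightarrow> real" where
  "bernoulli_num m = bernoulli_poly m 0"

(* The family characterised by the generating function exists and is unique,
   so that the definite description above is meaningful. *)

lemma sums_ball_unique:
  fixes a b :: "nat \<Rightarrow> complex"
  assumes r: "r > 0"
    and a: "\<And>z. norm z < r \<Longrightarrow> (\<lambda>m. a m * z ^ m) sums f z"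
    and b: "\<And>z. norm z < r \<Longrightarrow> (\<lambda>m. b m * z ^ m) sums f z"
  shows "a = b"
proof -
  define z0 where "z0 = complex_of_real (r / 2)"
  have z0: "norm z0 < r" "norm z0 > 0"
    using r by (auto simp: z0_def)
  have "fps_conv_radius (Abs_fps a) \<ge> norm z0"
    unfolding fps_conv_radius_def using a[OF z0(1)]
    by (intro conv_radius_geI) (auto simp: sums_iff)
  hence ra: "fps_conv_radius (Abs_fps a) > 0"
    using z0(2) by (meson ereal_less(2) less_le_trans)
  have "fps_conv_radius (Abs_fps b) \<ge> norm z0"
    unfolding fps_conv_radius_def using b[OF z0(1)]
    by (intro conv_radius_geI) (auto simp: sums_iff)
  hence rb: "fps_conv_radius (Abs_fps b) > 0"
    using z0(2) by (meson ereal_less(2) less_le_trans)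
  have ev: "eventually (\<lambda>z. z \<in> ball 0 r) (nhds (0::complex))"
    using r by (intro eventually_nhds_in_open) auto
  have "eventually (\<lambda>z. eval_fps (Abs_fps a) z = eval_fps (Abs_fps b) z) (nhds 0)"
    using ev
  proof eventually_elim
    case (elim z)
    thus ?case using a[of z] b[of z] by (simp add: eval_fps_def sums_iff)
  qed
  with ra rb have "Abs_fps a = Abs_fps b"
    by (intro eval_fps_eqD)
  thus ?thesis
    by (simp add: fps_eq_iff fun_eq_iff)
qed

lemma exp_neq_1_ball:
  assumes "norm z < 2 * pi" "z \<noteq> 0"
  shows "exp z \<noteq> (1::complex)"
proof
  assume "exp z = 1"
  then obtain n :: int where n: "Re z = 0" "Im z = of_int (2 * n) * pi"
    by (auto simp: exp_eq_1)
  with assms(2) have "n \<noteq> 0"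
    by (auto simp: complex_eq_iff)
  hence "\<bar>real_of_int n\<bar> \<ge> 1"
    by linarith
  hence "\<bar>Im z\<bar> \<ge> 2 * pi"
    by (simp add: n abs_mult)
  thus False
    using abs_Im_le_cmod[of z] assms(1) by linarith
qed

lemma bernoulli_gen_holomorphic:
  "bernoulli_gen t holomorphic_on ball 0 (2 * pi)"
proof -
  let ?g = "\<lambda>z::complex. z / (exp z - 1) * exp (complex_of_real t * z)"
  have "?g holomorphic_on ball 0 (2 * pi) - {0}"
    using exp_neq_1_ball by (intro holomorphic_intros) auto
  hence hol: "bernoulli_gen t holomorphic_on ball 0 (2 * pi) - {0}"
    by (rule holomorphic_transform) (auto simp: bernoulli_gen_def)
  have "((\<lambda>z::complex. inverse ((exp z - 1) / z) * exp (complex_of_real t * z))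
      \<longlongrightarrow> inverse 1 * exp (complex_of_real t * 0)) (at 0)"
    by (intro tendsto_intros lim_exp_minus_1) auto
  hence "((\<lambda>z::complex. inverse ((exp z - 1) / z) * exp (complex_of_real t * z))
      \<longlongrightarrow> 1) (at 0)"
    by simp
  hence "(bernoulli_gen t \<longlongrightarrow> 1) (at 0)"
    by (rule Lim_transform_eventually)
       (auto simp: bernoulli_gen_def eventually_at_filter)
  hence c0: "isCont (bernoulli_gen t) 0"
    by (simp add: isCont_def bernoulli_gen_def)
  have "continuous_on (ball 0 (2 * pi)) (bernoulli_gen t)"
  proof (rule continuous_at_imp_continuous_on, intro ballI)
    fix z :: complex assume z: "z \<in> ball 0 (2 * pi)"
    show "isCont (bernoulli_gen t) z"
    proof (cases "z = 0")
      case False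
      have "open (ball 0 (2 * pi) - {0 :: complex})" by auto
      with holomorphic_on_imp_continuous_on[OF hol] z False show ?thesis
        by (simp add: continuous_on_eq_continuous_at)
    qed (use c0 in auto)
  qed
  thus ?thesis
    by (rule no_isolated_singularity[OF _ hol]) auto
qed

lemma bernoulli_gen_cnj: "cnj (bernoulli_gen t (cnj z)) = bernoulli_gen t z"
  by (simp add: bernoulli_gen_def exp_cnj)

lemma ex1_bernoulli_family: "\<exists>!B. is_bernoulli_family B"
proof (rule ex_ex1I)
  define c where "c t m = (deriv ^^ m) (bernoulli_gen t) 0 / fact m" for t :: real and m :: nat
  have c: "(\<lambda>m. c t m * z ^ m) sums bernoulli_gen t z" if "norm z < 2 * pi" for t z
    using holomorphic_power_series[OF bernoulli_gen_holomorphic, of z t] that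
    by (simp add: c_def)
  have c': "(\<lambda>m. cnj (c t m) * z ^ m) sums bernoulli_gen t z" if "norm z < 2 * pi" for t z
  proof -
    have "(\<lambda>m. cnj (c t m * cnj z ^ m)) sums cnj (bernoulli_gen t (cnj z))"
      using c[of "cnj z" t] that by (subst sums_cnj) simp
    thus ?thesis by (simp add: bernoulli_gen_cnj)
  qed
  have real: "complex_of_real (Re (c t m)) = c t m" for t m
  proof -
    have "c t = (\<lambda>m. cnj (c t m))"
      by (rule sums_ball_unique[of "2 * pi" _ "bernoulli_gen t"]) (use c c' in auto)
    hence "c t m = cnj (c t m)" by (rule fun_cong)
    thus ?thesis by (simp add: complex_eq_iff)
  qed
  have "is_bernoulli_family (\<lambda>m t. Re (c t m) * fact m)"
    unfolding is_bernoulli_family_def using c by (simp add: real)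
  thus "\<exists>B. is_bernoulli_family B" by blast
next
  fix B B' assume B: "is_bernoulli_family B" and B': "is_bernoulli_family B'"
  have eq: "(\<lambda>m. complex_of_real (B m t) / fact m) = (\<lambda>m. complex_of_real (B' m t) / fact m)" for t
    by (rule sums_ball_unique[of "2 * pi" _ "bernoulli_gen t"])
       (use B B' in \<open>auto simp: is_bernoulli_family_def\<close>)
  have "B m t = B' m t" for m t
    using fun_cong[of _ _ m, OF eq[of t]] by simp
  thus "B = B'" by (intro ext)
qed

lemma is_bernoulli_family_bernoulli_poly: "is_bernoulli_family bernoulli_poly"
  unfolding bernoulli_poly_def by (rule theI'[OF ex1_bernoulli_family])

end

theory Submission
  imports Defs
begin

text \<open>
  Since the generating function at \<open>x\<close> is the one at \<open>0\<close> times \<open>exp (x z)\<close>, the Cauchy product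
  gives \<open>B\<^sub>m(x) = \<Sum>\<^sub>k (m choose k) B\<^bsub>m-k\<^esub> x\<^sup>k\<close>. Hence \<open>B\<^sub>m' = m B\<^bsub>m-1\<^esub>\<close>, the
  \<open>n\<close>-th derivative of \<open>B\<^sub>m\<close> is \<open>m! / (m-n)!\<close> times \<open>B\<^bsub>m-n\<^esub>\<close>, and integrating it against the
  kernel \<open>(t - s)\<^bsup>n-\<alpha>-1\<^esup>\<close> term by term leaves Beta integrals.
\<close>

text \<open>Puts the defining series into the shape \<open>a m * z ^ m\<close> on which
  \<open>sums_ball_unique\<close> and the power series lemmas operate.\<close>

lemma bernoulli_poly_sums:
  "norm z < 2 * pi \<Longrightarrow>
    (\<lambda>m. complex_of_real (bernoulli_poly m x) / fact m * z ^ m) sums bernoulli_gen x z"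
  using is_bernoulli_family_bernoulli_poly unfolding is_bernoulli_family_def by simp

lemma bernoulli_poly_eq:
  "bernoulli_poly m x = (\<Sum>k\<le>m. real (m choose k) * bernoulli_num (m - k) * x ^ k)"
proof -
  \<comment> \<open>\<open>a\<close> and \<open>b\<close> are the Taylor coefficients at 0 of
    \<open>exp (x * z)\<close> and of \<open>bernoulli_gen 0\<close>, the two factors of
    \<open>bernoulli_gen x\<close>.\<close>
  define a :: "nat \<Rightarrow> complex" where "a k = of_real x ^ k / fact k" for k
  define b :: "nat \<Rightarrow> complex" where "b k = of_real (bernoulli_num k) / fact k" for k
  have prod: "(\<lambda>j. (\<Sum>k\<le>j. a k * b (j - k)) * z ^ j) sums bernoulli_gen x z"
    if z: "norm z < 2 * pi" for z
  proof -
    have a: "(\<lambda>k. a k * z ^ k) = (\<lambda>k. (of_real x * z) ^ k /\<^sub>R fact k)"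
      by (simp add: a_def power_mult_distrib scaleR_conv_of_real divide_inverse mult_ac)
    have a_sum: "(\<Sum>k. a k * z ^ k) = exp (of_real x * z)"
      by (simp add: a exp_def)
    have a_abs: "summable (\<lambda>k. norm (a k * z ^ k))"
      unfolding fun_cong[OF a] by (rule summable_norm_exp)
    \<comment> \<open>The Cauchy product needs absolute convergence at \<open>z\<close>. It follows
      from plain convergence at any point of larger modulus; \<open>w\<close> has modulus halfway
      between \<open>norm z\<close> and \<open>2 * pi\<close>, so it still lies in the disc of
      convergence.\<close>
    define w where "w = complex_of_real ((norm z + 2 * pi) / 2)"
    have w: "norm w = (norm z + 2 * pi) / 2"
      unfolding w_def norm_of_real using norm_ge_zero[of z] pi_gt_zero by simp
    have "summable (\<lambda>k. b k * w ^ k)"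
      unfolding b_def bernoulli_num_def using z w by (intro sums_summable[OF bernoulli_poly_sums]) simp
    hence b_abs: "summable (\<lambda>k. norm (b k * z ^ k))"
      by (rule powser_insidea) (use z w in simp)
    have b_sum: "(\<Sum>k. b k * z ^ k) = bernoulli_gen 0 z"
      using bernoulli_poly_sums[OF z, of 0] by (simp add: b_def bernoulli_num_def sums_iff)
    have "(\<lambda>j. \<Sum>k\<le>j. (a k * z ^ k) * (b (j - k) * z ^ (j - k))) sums
            (exp (of_real x * z) * bernoulli_gen 0 z)"
      using Cauchy_product_sums[OF a_abs b_abs] by (simp add: a_sum b_sum)
    also have "exp (of_real x * z) * bernoulli_gen 0 z = bernoulli_gen x z"
      by (simp add: bernoulli_gen_def)
    also have "(\<lambda>j. \<Sum>k\<le>j. (a k * z ^ k) * (b (j - k) * z ^ (j - k))) =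
                 (\<lambda>j. (\<Sum>k\<le>j. a k * b (j - k)) * z ^ j)"
    proof
      fix j
      have "(a k * z ^ k) * (b (j - k) * z ^ (j - k)) = a k * b (j - k) * z ^ j" if "k \<le> j" for k
        using that by (simp add: mult_ac flip: power_add)
      thus "(\<Sum>k\<le>j. (a k * z ^ k) * (b (j - k) * z ^ (j - k))) = (\<Sum>k\<le>j. a k * b (j - k)) * z ^ j"
        unfolding sum_distrib_right by (intro sum.cong) auto
    qed
    finally show ?thesis .
  qed
  \<comment> \<open>Two power series with the same sum on a disc have the same coefficients.\<close>
  have "(\<lambda>m. complex_of_real (bernoulli_poly m x) / fact m) = (\<lambda>m. \<Sum>k\<le>m. a k * b (m - k))"
    by (rule sums_ball_unique[of "2 * pi" _ "bernoulli_gen x", OF _ bernoulli_poly_sums prod]) simp_all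
  hence "complex_of_real (bernoulli_poly m x) / fact m = (\<Sum>k\<le>m. a k * b (m - k))"
    by (rule fun_cong)
  hence "complex_of_real (bernoulli_poly m x) = fact m * (\<Sum>k\<le>m. a k * b (m - k))"
    by (simp add: field_simps)
  also have "\<dots> = complex_of_real (\<Sum>k\<le>m. real (m choose k) * bernoulli_num (m - k) * x ^ k)"
    by (simp add: sum_distrib_left a_def b_def binomial_fact mult_ac)
  finally show ?thesis
    by (simp only: of_real_eq_iff)
qed

lemma has_field_derivative_bernoulli_poly:
  "(bernoulli_poly (Suc m) has_field_derivative real (Suc m) * bernoulli_poly m x) (at x)"
proof -
  let ?c = "\<lambda>m k. real (m choose k) * bernoulli_num (m - k)"
  have "((\<lambda>x. \<Sum>k\<le>Suc m. ?c (Suc m) k * x ^ k) has_field_derivative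
          (\<Sum>k\<le>Suc m. ?c (Suc m) k * (real k * x ^ (k - Suc 0)))) (at x)"
    by (intro DERIV_sum DERIV_cmult DERIV_pow)
  \<comment> \<open>The constant term k = 0 differentiates to 0, so the sum can be reindexed from k
    to \<open>Suc k\<close>. The absorption identity for binomials then pulls out
    \<open>Suc m\<close>.\<close>
  also have "(\<Sum>k\<le>Suc m. ?c (Suc m) k * (real k * x ^ (k - Suc 0))) =
               (\<Sum>k\<le>m. real (Suc k * (Suc m choose Suc k)) * bernoulli_num (m - k) * x ^ k)"
    by (subst sum.atMost_Suc_shift) (simp add: mult_ac del: binomial_Suc_Suc of_nat_Suc mult_Suc)
  also have "\<dots> = (\<Sum>k\<le>m. real (Suc m) * (?c m k * x ^ k))"
    by (simp only: Suc_times_binomial of_nat_mult mult.assoc)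
  also have "\<dots> = real (Suc m) * bernoulli_poly m x"
    by (simp only: bernoulli_poly_eq sum_distrib_left)
  finally show ?thesis
    by (simp only: bernoulli_poly_eq[abs_def])
qed

lemma higher_deriv_bernoulli_poly:
  "n \<le> m \<Longrightarrow> (deriv ^^ n) (bernoulli_poly m) = (\<lambda>x. fact m / fact (m - n) * bernoulli_poly (m - n) x)"
proof (induction n)
  case (Suc n)
  define j where "j = m - Suc n"
  have j: "m - n = Suc j"
    using Suc.prems by (simp add: j_def)
  have "((\<lambda>x. fact m / fact (Suc j) * bernoulli_poly (Suc j) x) has_field_derivative
          fact m / fact (Suc j) * (real (Suc j) * bernoulli_poly j x)) (at x)" for x
    by (intro DERIV_cmult has_field_derivative_bernoulli_poly)
  hence "deriv (\<lambda>x. fact m / fact (Suc j) * bernoulli_poly (Suc j) x) =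
           (\<lambda>x. fact m / fact (Suc j) * (real (Suc j) * bernoulli_poly j x))"
    by (intro ext DERIV_imp_deriv)
  \<comment> \<open>\<open>Suc j\<close> cancels against
    \<open>fact (Suc j) = Suc j * fact j\<close>.\<close>
  also have "\<dots> = (\<lambda>x. fact m / fact j * bernoulli_poly j x)"
    by (simp add: field_simps del: of_nat_Suc)
  finally show ?case
    using Suc j by (simp flip: j_def)
qed simp

text \<open>\<open>has_integral_Beta_real\<close> speaks of the gauge integral. As the integrand is
  nonnegative, the value passes to the nonnegative Lebesgue integral, which being finite yields
  integrability and value at once.\<close>

lemma has_bochner_integral_Beta:
  fixes a b :: real
  assumes "a > 0" "b > 0"
  shows "has_bochner_integral lborel
           (\<lambda>s. indicator {0..1} s * (s powr (a - 1) * (1 - s) powr (b - 1))) (Beta a b)"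
proof (rule has_bochner_integral_nn_integral)
  show nonneg: "0 \<le> Beta a b"
    using assms by (simp add: Beta_def Gamma_real_pos less_imp_le)
  have "Beta a b = (\<integral>\<^sup>+ s. indicator {0..1} s * ennreal (s powr (a - 1) * (1 - s) powr (b - 1)) \<partial>lborel)"
    using nn_integral_has_integral_lebesgue[OF _ has_integral_Beta_real[OF assms]]
    by (simp add: ennreal_mult' ennreal_indicator)
  thus "(\<integral>\<^sup>+ s. ennreal (indicator {0..1} s * (s powr (a - 1) * (1 - s) powr (b - 1))) \<partial>lborel) = Beta a b"
    by (simp add: ennreal_mult' ennreal_indicator)
qed (auto intro!: AE_I2)

text \<open>Rescaling \<open>s\<close> to \<open>t * s\<close> reduces this to the Beta integral on
  the unit interval. The integrand contributes \<open>t powr (k + b - 1)\<close> and the Jacobian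
  one more factor \<open>t\<close>.\<close>

lemma has_bochner_integral_power_kernel:
  fixes b t :: real
  assumes "b > 0" "t > 0"
  shows "has_bochner_integral lborel (\<lambda>s. indicator {0..t} s * (s ^ k * (t - s) powr (b - 1)))
           (t powr (real k + b) * Beta (real k + 1) b)"
proof (subst lborel_has_bochner_integral_real_affine_iff[where t = 0 and c = t])
  show "t \<noteq> 0"
    using assms by simp
  have "has_bochner_integral lborel
          (\<lambda>s. t powr (real k + b - 1) *
            (indicator {0..1} s * (s powr (real k + 1 - 1) * (1 - s) powr (b - 1))))
          (t powr (real k + b - 1) * Beta (real k + 1) b)"
    using has_bochner_integral_Beta[of "real k + 1" b] assms
    by (intro has_bochner_integral_mult_right) auto
  also have "?this \<longleftrightarrow> has_bochner_integral lborel
      (\<lambda>s. indicator {0..t} (0 + t * s) * ((0 + t * s) ^ k * (t - (0 + t * s)) powr (b - 1)))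
      (t powr (real k + b - 1) * Beta (real k + 1) b)"
  proof (rule has_bochner_integral_cong_AE)
    \<comment> \<open>The point 0 has to be left out: for k = 0 the left side contains
      \<open>0 powr 0 = 0\<close>, the right side \<open>0 ^ 0 = 1\<close>.\<close>
    show "AE s in lborel. t powr (real k + b - 1) *
            (indicator {0..1} s * (s powr (real k + 1 - 1) * (1 - s) powr (b - 1))) =
          indicator {0..t} (0 + t * s) * ((0 + t * s) ^ k * (t - (0 + t * s)) powr (b - 1))"
      using AE_lborel_singleton[of 0]
    proof eventually_elim
      case (elim s)
      show ?case
      proof (cases "0 < s \<and> s \<le> 1")
        case True
        have "(t - t * s) powr (b - 1) = (t * (1 - s)) powr (b - 1)"
          by (simp add: algebra_simps)
        also have "\<dots> = t powr (b - 1) * (1 - s) powr (b - 1)"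
          using True assms by (simp add: powr_mult)
        finally have "(t - t * s) powr (b - 1) = t powr (b - 1) * (1 - s) powr (b - 1)" .
        moreover have "t powr (real k + b - 1) = t ^ k * t powr (b - 1)"
          unfolding add_diff_eq[symmetric] powr_add using assms by (simp add: powr_realpow)
        ultimately show ?thesis
          using True assms
          by (simp add: powr_realpow power_mult_distrib indicator_def mult_left_le)
      next
        case False
        with elim have "s < 0 \<or> s > 1"
          by auto
        thus ?thesis
          using assms by (auto simp: indicator_def mult_le_cancel_left1 zero_le_mult_iff)
      qed
    qed
  qed auto
  finally show "has_bochner_integral lborel
      (\<lambda>s. indicator {0..t} (0 + t * s) * ((0 + t * s) ^ k * (t - (0 + t * s)) powr (b - 1)))
      (t powr (real k + b) * Beta (real k + 1) b /\<^sub>R \<bar>t\<bar>)"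
    using assms by (simp add: powr_diff field_simps)
qed

theorem theorem5:
  fixes \<alpha> t :: real and n m :: nat
  assumes "\<alpha> > 0"
    and "int n = \<lceil>\<alpha>\<rceil>"
    and "m \<ge> n"
    and "t > 0"
  shows "caputo_deriv \<alpha> (bernoulli_poly m) t =
    Gamma (real m + 1) / Gamma (real m - real n + 1) *
      (\<Sum>k=0..m - n. fact k * real ((m - n) choose k) * bernoulli_num (m - n - k)
          / Gamma (real n + real k - \<alpha> + 1) * t powr (real k - \<alpha> + real n))"
proof -
  define j where "j = m - n"
  \<comment> \<open>With this \<beta> the Caputo kernel is \<open>(t - s) powr (\<beta> - 1)\<close>
    and its normalising factor is \<open>1 / Gamma \<beta>\<close>.\<close>
  define \<beta> where "\<beta> = real n - \<alpha>"
  define C :: real where "C = fact m / fact j"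
  have n: "nat \<lceil>\<alpha>\<rceil> = n"
    using assms(2) by simp
  have deriv: "(deriv ^^ n) (bernoulli_poly m) = (\<lambda>x. C * bernoulli_poly j x)"
    using higher_deriv_bernoulli_poly[OF assms(3)] by (simp add: C_def j_def)
  have Gamma_quot: "Gamma (real m + 1) / Gamma (real m - real n + 1) = C"
  proof -
    \<comment> \<open>\<open>Gamma_fact\<close> evaluates Gamma at arguments of the form
      \<open>1 + real k\<close>.\<close>
    have "real m - real n + 1 = 1 + real j" "real m + 1 = 1 + real m"
      using assms(3) by (auto simp: j_def)
    thus ?thesis
      by (simp only: Gamma_fact C_def)
  qed
  have rhs: "(\<Sum>k=0..m - n. fact k * real ((m - n) choose k) * bernoulli_num (m - n - k)
               / Gamma (real n + real k - \<alpha> + 1) * t powr (real k - \<alpha> + real n)) =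
             (\<Sum>k\<le>j. fact k * real (j choose k) * bernoulli_num (j - k)
               / Gamma (real k + 1 + \<beta>) * t powr (real k + \<beta>))"
    by (simp add: j_def \<beta>_def atMost_atLeast0 algebra_simps)
  show ?thesis
  proof (cases "\<alpha> = real n")
    case True
    \<comment> \<open>For integer order \<beta> = 0, so \<open>fact k\<close> cancels against
      \<open>Gamma (k + 1)\<close> and the sum collapses to the expansion of
      \<open>bernoulli_poly j t\<close>.\<close>
    have "fact k / Gamma (real k + 1 + \<beta>) * t powr (real k + \<beta>) = t ^ k" for k
      using True assms(4) Gamma_fact[of k, where 'a = real]
      by (simp add: \<beta>_def powr_realpow add.commute)
    hence "fact k * real (j choose k) * bernoulli_num (j - k) / Gamma (real k + 1 + \<beta>) * t powr (real k + \<beta>)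
             = real (j choose k) * bernoulli_num (j - k) * t ^ k" for k
      by (metis (no_types, opaque_lifting) mult.assoc mult.commute times_divide_eq_left)
    hence "(\<Sum>k\<le>j. fact k * real (j choose k) * bernoulli_num (j - k)
             / Gamma (real k + 1 + \<beta>) * t powr (real k + \<beta>)) = bernoulli_poly j t"
      by (simp add: bernoulli_poly_eq)
    moreover have "caputo_deriv \<alpha> (bernoulli_poly m) t = C * bernoulli_poly j t"
      using True by (simp add: caputo_deriv_def n deriv)
    ultimately show ?thesis
      by (simp only: Gamma_quot rhs)
  next
    case False
    \<comment> \<open>A ceiling is at least its argument, and equality is excluded in this
      case.\<close>
    hence \<beta>: "\<beta> > 0"
      using assms(2) by (auto simp: \<beta>_def) linarith
    \<comment> \<open>Expanding \<open>bernoulli_poly j\<close> in monomials reduces the integral to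
      finitely many power kernels. The identity also holds at s = t, where both sides are 0 by the
      conventions for \<open>powr\<close> and division.\<close>
    have integrand: "indicator {0..t} s *\<^sub>R (C * bernoulli_poly j s / (t - s) powr (\<alpha> - real n + 1)) =
        (\<Sum>k\<le>j. C * real (j choose k) * bernoulli_num (j - k) *
           (indicator {0..t} s * (s ^ k * (t - s) powr (\<beta> - 1))))" for s
    proof -
      have "(t - s) powr (\<beta> - 1) = 1 / (t - s) powr (\<alpha> - real n + 1)"
        using powr_minus_divide[of "t - s" "\<alpha> - real n + 1"] by (simp add: \<beta>_def)
      thus ?thesis
        by (simp add: bernoulli_poly_eq sum_distrib_left sum_divide_distrib mult_ac)
    qed
    have "has_bochner_integral lborel
            (\<lambda>s. indicator {0..t} s *\<^sub>R (C * bernoulli_poly j s / (t - s) powr (\<alpha> - real n + 1)))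
            (\<Sum>k\<le>j. C * real (j choose k) * bernoulli_num (j - k) *
              (t powr (real k + \<beta>) * Beta (real k + 1) \<beta>))"
      unfolding integrand
      by (intro has_bochner_integral_sum has_bochner_integral_mult_right
            has_bochner_integral_power_kernel \<beta> assms(4))
    hence "(LBINT s:{0..t}. C * bernoulli_poly j s / (t - s) powr (\<alpha> - real n + 1)) =
             (\<Sum>k\<le>j. C * real (j choose k) * bernoulli_num (j - k) *
               (t powr (real k + \<beta>) * Beta (real k + 1) \<beta>))"
      unfolding set_lebesgue_integral_def by (rule has_bochner_integral_integral_eq)
    hence "caputo_deriv \<alpha> (bernoulli_poly m) t = 1 / Gamma \<beta> *
             (\<Sum>k\<le>j. C * real (j choose k) * bernoulli_num (j - k) *
               (t powr (real k + \<beta>) * Beta (real k + 1) \<beta>))"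
      using False by (simp add: caputo_deriv_def n deriv \<beta>_def)
    also have "\<dots> = C * (\<Sum>k\<le>j. fact k * real (j choose k) * bernoulli_num (j - k)
               / Gamma (real k + 1 + \<beta>) * t powr (real k + \<beta>))"
      unfolding sum_distrib_left
    \<comment> \<open>By Beta = Gamma * Gamma / Gamma, the \<open>Gamma \<beta>\<close> in the
      numerator cancels the Caputo normalisation, leaving
      \<open>fact k / Gamma (k + 1 + \<beta>)\<close>.\<close>
    proof (rule sum.cong)
      fix k
      have "Gamma \<beta> \<noteq> 0"
        using \<beta> by (simp add: Gamma_real_pos less_imp_neq[symmetric])
      moreover have "Gamma (real k + 1) = fact k"
        using Gamma_fact[of k, where 'a = real] by (simp add: add.commute)
      ultimately show "1 / Gamma \<beta> * (C * real (j choose k) * bernoulli_num (j - k) *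
              (t powr (real k + \<beta>) * Beta (real k + 1) \<beta>)) =
            C * (fact k * real (j choose k) * bernoulli_num (j - k)
              / Gamma (real k + 1 + \<beta>) * t powr (real k + \<beta>))"
        by (simp add: Beta_def)
    qed simp
    finally show ?thesis
      by (simp only: Gamma_quot rhs)
  qed
qed

end
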